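(* For each fixed integer $k\geqslant2$, we have $e_{k,m} \leqslant m^{-(k-o(1))m}$ as $m\to\infty$; that is, for every $\varepsilon>0$ there exists $m_0=m_0(k,\varepsilon)$ such that $e_{k,m}\leqslant m^{-(k-\varepsilon)m}$ for all integers $m\geqslant m_0$.
   Context: For a positive integer $n$, $\omega_k(n)$ is the number of primes $p$ with $p^k\,\|\,n$ (primes dividing $n$ with multiplicity exactly $k$). For integers $m\geqslant0$, $e_{k,m}=\lim_{x\to\infty}\frac1x\#\{n\leqslant x:\omega_k(n)=m\}$ is the natural density of the positive integers $n$ with $\omega_k(n)=m$ (this limit exists). *)

theory Defs
  imports Complex_Main "HOL-Computational_Algebra.Primes"
begin

text \<open>For \<open>k \<ge> 1\<close>, \<open>omega_mult k n\<close> is the number of primes \<open>p\<close> with \<open>p ^ k\<close> exactly dividing \<open>n\<close>.\<close>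

definition omega_mult :: "nat \<Rightarrow> nat \<Rightarrow> nat" where
  "omega_mult k n = card {p \<in> prime_factors n. multiplicity p n = k}"

text \<open>
  The limit is taken over real \<open>x\<close>. \<open>Lim\<close> is a definite description, so a bound on
  \<open>omega_density k m\<close> can only be derived after establishing that the limit exists.
\<close>

definition omega_density :: "nat \<Rightarrow> nat \<Rightarrow> real" where
  "omega_density k m =
     Lim at_top (\<lambda>x::real. real (card {n::nat. 0 < n \<and> real n \<le> x \<and> omega_mult k n = m}) / x)"

end

theory Submission
  imports Defs "HOL-Analysis.Analysis" "HOL-Real_Asymp.Real_Asymp"
begin

text \<open>
  Both the existence of the density \<open>e\<^sub>k\<^sub>,\<^sub>m\<close> and the bound on it come from union bounds
  over multiples of perfect powers.

  \<^emph>\<open>The limit exists.\<close> If only primes up to \<open>y\<close> are inspected, the condition on \<open>n\<close> becomes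
  periodic with period \<open>(y!)\<^sup>k\<^sup>+\<^sup>1\<close>, and periodic sets have a density (\<open>periodic_density\<close>).
  The inspection goes wrong only for those \<open>n\<close> that are divisible by the square of some number
  above \<open>y\<close>, which is where \<open>k \<ge> 2\<close> enters; these make up a proportion of at most
  \<open>\<Sum>\<^bsub>j > y\<^esub> j\<^sup>-\<^sup>2 \<le> 1 / y\<close>, uniformly in \<open>x\<close>. So the counting ratio is approximated uniformly by
  convergent functions and therefore converges (\<open>omega_density_limit_exists\<close>).

  \<^emph>\<open>The bound.\<close> If \<open>\<omega>\<^sub>k(n) = m\<close>, then \<open>n\<close> is a multiple of \<open>(\<Prod>S)\<^sup>k\<close> for the set \<open>S\<close> of its \<open>m\<close> primes
  of multiplicity \<open>k\<close>. Hence \<open>e\<^sub>k\<^sub>,\<^sub>m \<le> \<Sum>\<^bsub>|S| = m\<^esub> (\<Prod>S)\<^sup>-\<^sup>k\<close>, and this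
  sum only grows when \<open>S\<close> ranges over all \<open>m\<close>-element sets of positive integers.
  Two facts about such sets each save a power of \<open>m!\<close>, that is of \<open>m\<^sup>m\<close> up to a factor
  exponential in \<open>m\<close>. Fix an exponent \<open>s\<close> slightly above \<open>1\<close>. Since \<open>m\<close> distinct positive integers have
  product at least \<open>m!\<close>, we have \<open>(\<Prod>S)\<^sup>-\<^sup>k \<le> (m!)\<^bsup>-(k-s)\<^esup> (\<Prod>S)\<^bsup>-s\<^esup>\<close>
  (\<open>inverse_prod_power_le\<close>). And \<open>\<Sum>\<^bsub>|S| = m\<^esub> (\<Prod>S)\<^bsup>-s\<^esup>\<close> is an elementary symmetric function of terms
  with the finite sum \<open>\<zeta>(s)\<close>, so it is at most \<open>(exp(\<zeta>(s)) / m)\<^sup>m\<close> (\<open>sum_prod_subsets_le\<close>).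
  Together this gives \<open>C\<^sup>m m\<^bsup>-(k-s+1)m\<^esup>\<close>, and with \<open>s = 1 + \<delta>\<close> the factor \<open>C\<^sup>m\<close> is absorbed by
  another \<open>m\<^bsup>\<delta>m\<^esup>\<close> for large \<open>m\<close>.
\<close>

section \<open>Counting positive integers up to a real bound\<close>

definition counting :: "(nat \<Rightarrow> bool) \<Rightarrow> real \<Rightarrow> real" where
  "counting P x = real (card {n. 0 < n \<and> real n \<le> x \<and> P n})"

lemma finite_positive_le [simp]: "finite {n::nat. 0 < n \<and> real n \<le> x \<and> P n}"
proof (rule finite_subset)
  show "{n::nat. 0 < n \<and> real n \<le> x \<and> P n} \<subseteq> {..nat \<lfloor>x\<rfloor>}"
    by (auto simp: le_nat_floor)
qed simp

lemma counting_mono: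
  assumes "\<And>n. 0 < n \<Longrightarrow> real n \<le> x \<Longrightarrow> P n \<Longrightarrow> Q n"
  shows "counting P x \<le> counting Q x"
  unfolding counting_def using assms by (intro of_nat_mono card_mono) auto

lemma counting_disj_le: "counting (\<lambda>n. P n \<or> Q n) x \<le> counting P x + counting Q x"
proof -
  have "{n. 0 < n \<and> real n \<le> x \<and> (P n \<or> Q n)} =
      {n. 0 < n \<and> real n \<le> x \<and> P n} \<union> {n. 0 < n \<and> real n \<le> x \<and> Q n}" by auto
  thus ?thesis unfolding counting_def
    by (metis (no_types, lifting) card_Un_le of_nat_add of_nat_mono)
qed

lemma counting_Bex_le:
  assumes "finite I"
  shows "counting (\<lambda>n. \<exists>i\<in>I. P i n) x \<le> (\<Sum>i\<in>I. counting (P i) x)"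
  using assms
proof (induction I rule: finite_induct)
  case empty
  show ?case by (simp add: counting_def)
next
  case (insert i I)
  have "counting (\<lambda>n. \<exists>j\<in>insert i I. P j n) x = counting (\<lambda>n. P i n \<or> (\<exists>j\<in>I. P j n)) x"
    by simp
  also have "\<dots> \<le> counting (P i) x + counting (\<lambda>n. \<exists>j\<in>I. P j n) x" by (rule counting_disj_le)
  finally show ?case using insert by simp
qed

lemma counting_dvd_le:
  assumes "d > 0" "x \<ge> 0"
  shows "counting (\<lambda>n. d dvd n) x \<le> x / real d"
proof -
  have "{n. 0 < n \<and> real n \<le> x \<and> d dvd n} \<subseteq> (\<lambda>j. d * j) ` {1..nat \<lfloor>x / d\<rfloor>}"
  proof
    fix n assume "n \<in> {n. 0 < n \<and> real n \<le> x \<and> d dvd n}"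
    then obtain j where n: "n = d * j" "0 < d * j" "real (d * j) \<le> x" by (auto elim: dvdE)
    hence "real j \<le> x / d" using assms by (simp add: field_simps)
    hence "j \<le> nat \<lfloor>x / d\<rfloor>" by (simp add: le_nat_floor)
    thus "n \<in> (\<lambda>j. d * j) ` {1..nat \<lfloor>x / d\<rfloor>}" using n by auto
  qed
  hence "card {n. 0 < n \<and> real n \<le> x \<and> d dvd n} \<le> card ((\<lambda>j. d * j) ` {1..nat \<lfloor>x / d\<rfloor>})"
    by (intro card_mono) auto
  also have "\<dots> \<le> nat \<lfloor>x / d\<rfloor>" using card_image_le[of "{1..nat \<lfloor>x / d\<rfloor>}" "\<lambda>j. d * j"] by simp
  finally have "counting (\<lambda>n. d dvd n) x \<le> real (nat \<lfloor>x / d\<rfloor>)" by (simp add: counting_def)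
  also have "\<dots> \<le> x / d" using assms by (simp add: of_nat_floor)
  finally show ?thesis .
qed

section \<open>Existence of the density\<close>

lemma periodic_density:
  fixes P :: "nat \<Rightarrow> bool"
  assumes "M > 0" and per: "\<And>n. P (n + M) = P n"
  shows "\<exists>d. ((\<lambda>x. counting P x / x) \<longlongrightarrow> d) at_top"
proof -
  define c where "c N = card {n\<in>{0<..N}. P n}" for N
  define d where "d = real (c M) / real M"
  have c_le: "c N \<le> N" for N
    using card_mono[of "{0<..N}" "{n\<in>{0<..N}. P n}"] unfolding c_def by fastforce
  \<comment> \<open>Cut off the first period and shift the rest down by \<open>M\<close>.\<close>
  have c_add: "c (N + M) = c N + c M" for N
  proof -
    have "{n\<in>{0<..N + M}. P n} = {n\<in>{0<..M}. P n} \<union> (\<lambda>n. n + M) ` {n\<in>{0<..N}. P n}"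
    proof (intro set_eqI iffI)
      fix n assume n: "n \<in> {n\<in>{0<..N + M}. P n}"
      show "n \<in> {n\<in>{0<..M}. P n} \<union> (\<lambda>n. n + M) ` {n\<in>{0<..N}. P n}"
      proof (cases "n \<le> M")
        case False
        hence "n = (n - M) + M" "P (n - M)" using n per[of "n - M"] by auto
        thus ?thesis using n False by (intro UnI2 image_eqI[of _ _ "n - M"]) auto
      qed (use n in auto)
    qed (use per in auto)
    also have "card \<dots> = c M + c N" unfolding c_def
      by (subst card_Un_disjoint) (auto simp: card_image)
    finally show ?thesis by (simp add: c_def)
  qed
  have d: "0 \<le> d" "d \<le> 1" "real (c M) = d * M" using c_le[of M] \<open>M > 0\<close> by (auto simp: d_def)
  \<comment> \<open>Removing a full period from \<open>N\<close> leaves the difference unchanged, so only the remainder of \<open>N\<close>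
    modulo \<open>M\<close> contributes to the error.\<close>
  have approx: "\<bar>real (c N) - d * N\<bar> \<le> M" for N
  proof (induction N rule: less_induct)
    case (less N)
    show ?case
    proof (cases "N < M")
      case True
      have "real (c N) \<le> M" using c_le[of N] True by simp
      moreover have "d * real N \<le> 1 * real M" using True d by (intro mult_mono) auto
      moreover have "0 \<le> d * real N" using d by simp
      ultimately show ?thesis by simp
    next
      case False
      then obtain L where L: "N = L + M" using le_Suc_ex[of M N] by (auto simp: add.commute)
      have "real (c N) - d * N = real (c L) - d * L"
        using c_add[of L] d by (simp add: L algebra_simps)
      thus ?thesis using less[of L] L \<open>M > 0\<close> by simp
    qed
  qed
  have bound: "norm (counting P x / x - d) \<le> (real M + 1) / x" if x: "x > 0" for x
  proof -
    have "{n. 0 < n \<and> real n \<le> x \<and> P n} = {n\<in>{0<..nat \<lfloor>x\<rfloor>}. P n}"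
      using x by (auto simp: le_nat_floor le_nat_iff le_floor_iff)
    hence eq: "counting P x = c (nat \<lfloor>x\<rfloor>)" by (simp add: counting_def c_def)
    have fl: "0 \<le> x - nat \<lfloor>x\<rfloor>" "x - nat \<lfloor>x\<rfloor> \<le> 1" using x by linarith+
    have "d * (x - nat \<lfloor>x\<rfloor>) \<le> 1 * 1" "0 \<le> d * (x - nat \<lfloor>x\<rfloor>)"
      using d fl by (intro mult_mono mult_nonneg_nonneg; simp)+
    hence "\<bar>counting P x - d * x\<bar> \<le> M + 1"
      using approx[of "nat \<lfloor>x\<rfloor>"] unfolding eq by (simp add: algebra_simps abs_le_iff)
    moreover have "counting P x / x - d = (counting P x - d * x) / x" using x by (simp add: field_simps)
    ultimately show ?thesis using x by (simp add: divide_right_mono)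
  qed
  have "((\<lambda>x. counting P x / x - d) \<longlongrightarrow> 0) at_top"
  proof (rule Lim_null_comparison)
    show "\<forall>\<^sub>F x in at_top. norm (counting P x / x - d) \<le> (real M + 1) / x"
      using eventually_gt_at_top[of 0] by eventually_elim (rule bound)
    show "((\<lambda>x. (real M + 1) / x) \<longlongrightarrow> 0) at_top"
      by (intro tendsto_divide_0[OF tendsto_const] filterlim_at_top_imp_at_infinity filterlim_ident)
  qed
  thus ?thesis using Lim_null[of "\<lambda>x. counting P x / x" d at_top] by blast
qed

text \<open>
  Each \<open>g\<close> is eventually close to a constant, hence so is \<open>f\<close>, and \<open>f\<close> satisfies the Cauchy criterion.
\<close>

lemma tendsto_if_uniformly_approximable:
  fixes f :: "'a \<Rightarrow> 'b :: banach"
  assumes "F \<noteq> bot"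
    and "\<And>e. e > 0 \<Longrightarrow> \<exists>g l. (g \<longlongrightarrow> l) F \<and> (\<forall>\<^sub>F x in F. dist (f x) (g x) < e)"
  shows "\<exists>l. (f \<longlongrightarrow> l) F"
proof -
  have "cauchy_filter (filtermap f F)"
    unfolding cauchy_filter_metric_filtermap
  proof (intro allI impI)
    fix e :: real assume "e > 0"
    then obtain g l where g: "(g \<longlongrightarrow> l) F" "\<forall>\<^sub>F x in F. dist (f x) (g x) < e / 4"
      using assms(2)[of "e / 4"] by auto
    have "\<forall>\<^sub>F x in F. dist (g x) l < e / 4" using g(1) \<open>e > 0\<close> by (intro tendstoD) auto
    with g(2) have ev: "\<forall>\<^sub>F x in F. dist (f x) l < e / 2"
    proof eventually_elim
      case (elim x)
      thus ?case using dist_triangle[of "f x" l "g x"] by simp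
    qed
    have "dist (f x) (f y) < e" if "dist (f x) l < e / 2" "dist (f y) l < e / 2" for x y
      using that by (rule dist_triangle_half_l)
    with ev show "\<exists>Q. eventually Q F \<and> (\<forall>x y. Q x \<and> Q y \<longrightarrow> dist (f x) (f y) < e)" by blast
  qed
  moreover have "filtermap f F \<noteq> bot" using assms(1) by (simp add: filtermap_bot_iff)
  ultimately show ?thesis
    using cauchy_filter_complete_converges[of "filtermap f F" UNIV] complete_UNIV
    by (auto simp: filterlim_def)
qed

text \<open>The terms are bounded by \<open>1 / (j - 1) - 1 / j\<close>, and these telescope.\<close>

lemma sum_inverse_squares_tail:
  assumes "y > 0"
  shows "(\<Sum>j\<in>{y<..N}. 1 / real j ^ 2) \<le> 1 / real y"
proof -
  have "(\<Sum>j\<in>{y<..N}. 1 / real j ^ 2) \<le> 1 / real y - 1 / real N" if "y \<le> N"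
    using that
  proof (induction N rule: dec_induct)
    case (step N)
    have "{y<..Suc N} = insert (Suc N) {y<..N}" using step by auto
    hence "(\<Sum>j\<in>{y<..Suc N}. 1 / real j ^ 2) \<le> 1 / real (Suc N) ^ 2 + (1 / real y - 1 / real N)"
      using step by simp
    also have "1 / real (Suc N) ^ 2 \<le> 1 / real N - 1 / real (Suc N)"
      using step assms by (simp add: divide_simps power2_eq_square)
    finally show ?case by simp
  qed simp
  moreover have "1 / real y - 1 / real N \<le> 1 / real y" by simp
  ultimately show ?thesis
    by (metis (no_types, lifting) order_trans greaterThanAtMost_empty nle_le sum.empty
        of_nat_0_le_iff zero_le_divide_1_iff)
qed

text \<open>
  Exact divisibility is phrased with \<open>dvd\<close> alone, since it is in this form that invariance under
  adding a multiple of \<open>p\<^sup>k\<^sup>+\<^sup>1\<close> to \<open>n\<close> is immediate.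
\<close>

definition exact_primes :: "nat \<Rightarrow> nat \<Rightarrow> nat set" where
  "exact_primes k n = {p. prime p \<and> p ^ k dvd n \<and> \<not> p ^ Suc k dvd n}"

lemma omega_mult_eq_card_exact_primes:
  assumes "k > 0" "n > 0"
  shows "omega_mult k n = card (exact_primes k n)"
proof -
  have "{p \<in> prime_factors n. multiplicity p n = k} = exact_primes k n"
  proof (intro set_eqI iffI)
    fix p assume "p \<in> {p \<in> prime_factors n. multiplicity p n = k}"
    hence p: "prime p" "multiplicity p n = k" by auto
    hence "p ^ j dvd n \<longleftrightarrow> j \<le> k" for j
      using assms power_dvd_iff_le_multiplicity[of n p j] not_prime_unit by blast
    with p show "p \<in> exact_primes k n" by (simp add: exact_primes_def del: power_Suc)
  next
    fix p assume "p \<in> exact_primes k n"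
    hence p: "prime p" "p ^ k dvd n" "\<not> p ^ Suc k dvd n" by (auto simp: exact_primes_def)
    moreover have "p dvd n" using p(2) \<open>k > 0\<close> by (meson dvd_power dvd_trans)
    ultimately show "p \<in> {p \<in> prime_factors n. multiplicity p n = k}"
      using assms by (auto simp: prime_factors_dvd intro: multiplicity_eqI)
  qed
  thus ?thesis by (simp add: omega_mult_def)
qed

text \<open>
  The approximating functions count the \<open>n\<close> with exactly \<open>m\<close> primes \<open>p \<le> y\<close> such that \<open>p\<^sup>k\<close>
  exactly divides \<open>n\<close>.
\<close>

lemma omega_density_limit_exists:
  assumes "k \<ge> 2"
  shows "\<exists>l. ((\<lambda>x. counting (\<lambda>n. omega_mult k n = m) x / x) \<longlongrightarrow> l) at_top"
proof (rule tendsto_if_uniformly_approximable)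
  fix e :: real assume "e > 0"
  then obtain y where y: "y > 0" "1 / real y < e"
    using nat_approx_posE by (metis zero_less_Suc)
  define P where "P n \<longleftrightarrow> omega_mult k n = m" for n
  define Q where "Q n \<longleftrightarrow> card {p \<in> exact_primes k n. p \<le> y} = m" for n
  define M where "M = (fact y :: nat) ^ Suc k"
  have "p ^ Suc k dvd M" if "prime p" "p \<le> y" for p
    unfolding M_def using that prime_ge_1_nat[of p] by (intro dvd_power_same dvd_fact) auto
  moreover from this have "p ^ k dvd M" if "prime p" "p \<le> y" for p :: nat
    using that by (meson dvd_trans le_imp_power_dvd lessI less_imp_le)
  ultimately have "{p \<in> exact_primes k (n + M). p \<le> y} = {p \<in> exact_primes k n. p \<le> y}" for n
    unfolding exact_primes_def by (auto simp del: power_Suc simp: dvd_add_left_iff)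
  hence "Q (n + M) = Q n" for n by (simp add: Q_def)
  moreover have "M > 0" by (simp add: M_def)
  ultimately obtain l where l: "((\<lambda>x. counting Q x / x) \<longlongrightarrow> l) at_top"
    using periodic_density by blast
  have close: "dist (counting P x / x) (counting Q x / x) < e" if x: "x > 0" for x
  proof -
    define N where "N = nat \<lfloor>x\<rfloor>"
    define D where "D n \<longleftrightarrow> (\<exists>j\<in>{y<..N}. j ^ 2 dvd n)" for n
    \<comment> \<open>If the truncated and the full count disagree at \<open>n\<close>, some prime \<open>p > y\<close> is responsible,
      and \<open>p\<^sup>2\<close> divides \<open>n\<close> because \<open>k \<ge> 2\<close>.\<close>
    have "D n" if n: "0 < n" "real n \<le> x" and PQ: "P n \<noteq> Q n" for n
    proof -
      have "exact_primes k n \<noteq> {p \<in> exact_primes k n. p \<le> y}"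
        using PQ n assms by (auto simp: P_def Q_def omega_mult_eq_card_exact_primes)
      then obtain p where p: "p \<in> exact_primes k n" "p > y" by fastforce
      hence "p ^ k dvd n" by (simp add: exact_primes_def)
      hence p2: "p ^ 2 dvd n" using assms le_imp_power_dvd dvd_trans by blast
      hence "p dvd n" by (meson dvd_power dvd_trans zero_less_numeral)
      hence "p \<le> n" using n by (simp add: dvd_imp_le)
      hence "p \<le> N" using n by (simp add: N_def le_nat_floor)
      thus ?thesis using p p2 by (auto simp: D_def)
    qed
    hence "counting P x \<le> counting (\<lambda>n. Q n \<or> D n) x" "counting Q x \<le> counting (\<lambda>n. P n \<or> D n) x"
      by (auto intro!: counting_mono)
    hence "\<bar>counting P x - counting Q x\<bar> \<le> counting D x"
      using counting_disj_le[of Q D x] counting_disj_le[of P D x] by linarith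
    also have "counting D x \<le> (\<Sum>j\<in>{y<..N}. counting (\<lambda>n. j ^ 2 dvd n) x)"
      unfolding D_def by (rule counting_Bex_le) simp
    also have "\<dots> \<le> (\<Sum>j\<in>{y<..N}. x / real (j ^ 2))"
      using x by (intro sum_mono counting_dvd_le) auto
    also have "\<dots> = x * (\<Sum>j\<in>{y<..N}. 1 / real j ^ 2)" by (simp add: sum_distrib_left)
    also have "\<dots> \<le> x * (1 / y)"
      using x y by (intro mult_left_mono sum_inverse_squares_tail) auto
    also have "\<dots> < x * e" using x y by (intro mult_strict_left_mono) auto
    finally have "\<bar>counting P x - counting Q x\<bar> / x < e" using x by (simp add: field_simps)
    thus ?thesis using x by (simp add: dist_real_def flip: diff_divide_distrib)
  qed
  have "\<forall>\<^sub>F x in at_top. dist (counting P x / x) (counting Q x / x) < e"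
    using eventually_gt_at_top[of 0] by eventually_elim (rule close)
  with l show "\<exists>g l. (g \<longlongrightarrow> l) at_top \<and>
      (\<forall>\<^sub>F x in at_top. dist (counting (\<lambda>n. omega_mult k n = m) x / x) (g x) < e)"
    unfolding P_def by blast
qed simp

section \<open>Sums over sets of fixed size\<close>

text \<open>
  The left-hand side is the coefficient of \<open>t\<^sup>m\<close> in \<open>\<Prod>\<^bsub>a \<in> A\<^esub> (1 + t f(a))\<close>, a polynomial with
  nonnegative coefficients that is bounded by \<open>exp(t \<Sum>\<^bsub>a \<in> A\<^esub> f(a))\<close> for \<open>t \<ge> 0\<close>. Evaluating at \<open>t = m\<close> gives the
  bound.
\<close>

lemma sum_prod_subsets_le:
  fixes f :: "'a \<Rightarrow> real"
  assumes "finite A" "\<And>a. a \<in> A \<Longrightarrow> f a \<ge> 0" "m > 0"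
  shows "(\<Sum>S | S \<subseteq> A \<and> card S = m. \<Prod>a\<in>S. f a) \<le> (exp (\<Sum>a\<in>A. f a) / m) ^ m"
proof -
  have "(\<Sum>S | S \<subseteq> A \<and> card S = m. \<Prod>a\<in>S. f a) * real m ^ m
      = (\<Sum>S | S \<subseteq> A \<and> card S = m. \<Prod>a\<in>S. real m * f a)"
    unfolding sum_distrib_right by (intro sum.cong refl) (auto simp: prod.distrib mult.commute)
  also have "\<dots> \<le> (\<Sum>S\<in>Pow A. \<Prod>a\<in>S. real m * f a)"
    using assms by (intro sum_mono2) (auto intro!: prod_nonneg)
  also have "\<dots> = (\<Prod>a\<in>A. real m * f a + 1)"
    using prod_add[OF assms(1), of "\<lambda>a. real m * f a" "\<lambda>_. 1"] by simp
  also have "\<dots> \<le> (\<Prod>a\<in>A. exp (real m * f a))"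
    using assms by (intro prod_mono) (auto simp: add.commute intro: add_nonneg_nonneg)
  also have "\<dots> = exp (\<Sum>a\<in>A. f a) ^ m"
    using assms(1) by (simp add: exp_sum sum_distrib_left exp_of_nat_mult flip: prod_power_distrib)
  finally show ?thesis using assms(3) by (simp add: field_simps power_divide)
qed

text \<open>
  The largest element of \<open>S\<close> is at least \<open>card S\<close>; remove it and induct.
\<close>

lemma fact_card_le_prod:
  fixes S :: "nat set"
  assumes "finite S" "0 \<notin> S"
  shows "fact (card S) \<le> \<Prod>S"
  using assms
proof (induction S rule: finite_linorder_max_induct)
  case (insert b A)
  have "A \<subseteq> {1..<b}" using insert by (auto simp: Suc_le_eq intro!: gr0I)
  hence "card A \<le> b - 1" using card_mono[of "{1..<b}" A] by simp
  hence "Suc (card A) \<le> b" using insert by auto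
  moreover have "b \<notin> A" using insert by auto
  ultimately show ?case using insert by (simp add: mult_le_mono del: mult_Suc)
qed simp

text \<open>A single term of the exponential series, \<open>m\<^sup>m / m!\<close>, is at most its sum \<open>exp(m)\<close>.\<close>

lemma power_div_exp_le_fact: "(real m / exp 1) ^ m \<le> fact m"
proof -
  have "(\<Sum>n\<in>{m}. real m ^ n /\<^sub>R fact n) \<le> exp (real m)"
    unfolding exp_def by (intro sum_le_suminf summable_exp_generic) auto
  hence "real m ^ m \<le> exp (real m) * fact m" by (simp add: field_simps)
  moreover have "exp (real m) = exp 1 ^ m" by (simp flip: exp_of_nat_mult)
  ultimately show ?thesis by (simp add: power_divide field_simps)
qed

text \<open>
  Part of the exponent \<open>k\<close> is spent on the lower bound \<open>m!\<close> for the product, while the remaining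
  part \<open>s\<close> is kept so that, for \<open>s > 1\<close>, the sum over all \<open>S\<close> still converges.
\<close>

lemma inverse_prod_power_le:
  fixes S :: "nat set" and s :: real
  assumes "finite S" "0 \<notin> S" "s \<le> real k"
  shows "1 / real (\<Prod>S) ^ k \<le> fact (card S) powr (s - k) * (\<Prod>a\<in>S. real a powr (- s))"
proof -
  have fact_le: "fact (card S) \<le> real (\<Prod>S)"
    using fact_card_le_prod[OF assms(1,2)] by (metis of_nat_fact of_nat_mono)
  hence pos: "real (\<Prod>S) > 0" using fact_gt_zero less_le_trans by blast
  have "1 / real (\<Prod>S) ^ k = real (\<Prod>S) powr (- real k)"
    using pos by (simp add: powr_realpow powr_minus_divide)
  also have "\<dots> = real (\<Prod>S) powr (s - k) * real (\<Prod>S) powr (- s)"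
    unfolding powr_add[symmetric] by simp
  also have "\<dots> \<le> fact (card S) powr (s - k) * real (\<Prod>S) powr (- s)"
    using fact_le assms by (intro mult_right_mono powr_mono2') auto
  also have "real (\<Prod>S) powr (- s) = (\<Prod>a\<in>S. real a powr (- s))"
    by (simp add: prod_powr_distrib)
  finally show ?thesis .
qed

section \<open>The upper bound\<close>

text \<open>
  This is the union bound over the possible sets \<open>S\<close> of primes that divide \<open>n\<close> exactly \<open>k\<close> times:
  at most \<open>x / (\<Prod>S)\<^sup>k\<close> of the integers up to \<open>x\<close> are divisible by \<open>(\<Prod>S)\<^sup>k\<close>. The estimate holds for
  each \<open>x\<close> and is linear in it, so it passes to the density.
\<close>

lemma counting_omega_mult_le:
  assumes "k > 0" "1 < s" "s \<le> real k" "m > 0" "x \<ge> 0"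
  shows "counting (\<lambda>n. omega_mult k n = m) x
    \<le> x * (fact m powr (s - k) * (exp (\<Sum>n. real n powr (- s)) / m) ^ m)"
proof -
  define N where "N = nat \<lfloor>x\<rfloor>"
  define I where "I = {S. S \<subseteq> {1..N} \<and> card S = m}"
  have I: "finite I" "\<And>S. S \<in> I \<Longrightarrow> finite S \<and> 0 \<notin> S \<and> card S = m"
    by (auto simp: I_def intro: finite_subset)
  have "\<exists>S\<in>I. (\<Prod>S) ^ k dvd n" if n: "0 < n" "real n \<le> x" "omega_mult k n = m" for n
  proof
    let ?S = "{p \<in> prime_factors n. multiplicity p n = k}"
    have "(\<Prod>?S) ^ k = (\<Prod>p\<in>?S. p ^ multiplicity p n)" by (simp add: prod_power_distrib)
    also have "\<dots> dvd (\<Prod>p\<in>prime_factors n. p ^ multiplicity p n)"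
      by (intro prod_dvd_prod_subset) auto
    also have "\<dots> = n" using n by (simp flip: prime_factorization_nat)
    finally show "(\<Prod>?S) ^ k dvd n" .
    have "p \<in> {1..N}" if "p \<in> ?S" for p
    proof -
      have "p dvd n" "prime p" using that by (auto simp: prime_factors_dvd)
      hence "p \<le> n" "p \<ge> 1" using n by (auto simp: dvd_imp_le prime_ge_1_nat)
      thus ?thesis using n by (auto simp: N_def le_nat_floor)
    qed
    thus "?S \<in> I" using n by (auto simp: I_def omega_mult_def)
  qed
  hence "counting (\<lambda>n. omega_mult k n = m) x \<le> counting (\<lambda>n. \<exists>S\<in>I. (\<Prod>S) ^ k dvd n) x"
    by (rule counting_mono)
  also have "\<dots> \<le> (\<Sum>S\<in>I. counting (\<lambda>n. (\<Prod>S) ^ k dvd n) x)"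
    by (rule counting_Bex_le) (rule I)
  also have "\<dots> \<le> (\<Sum>S\<in>I. x * (fact m powr (s - k) * (\<Prod>a\<in>S. real a powr (- s))))"
  proof (rule sum_mono)
    fix S assume S: "S \<in> I"
    have "\<Prod>S > 0" using I(2)[OF S] by (intro prod_pos) (metis gr0I)
    hence "counting (\<lambda>n. (\<Prod>S) ^ k dvd n) x \<le> x / real ((\<Prod>S) ^ k)"
      using assms by (intro counting_dvd_le) auto
    also have "\<dots> = x * (1 / real (\<Prod>S) ^ k)" by simp
    also have "\<dots> \<le> x * (fact m powr (s - k) * (\<Prod>a\<in>S. real a powr (- s)))"
      using inverse_prod_power_le[of S s k] I(2)[OF S] assms by (intro mult_left_mono) auto
    finally show "counting (\<lambda>n. (\<Prod>S) ^ k dvd n) x \<le> \<dots>" .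
  qed
  also have "\<dots> = x * (fact m powr (s - k) * (\<Sum>S\<in>I. \<Prod>a\<in>S. real a powr (- s)))"
    by (simp add: sum_distrib_left)
  also have "\<dots> \<le> x * (fact m powr (s - k) * (exp (\<Sum>a=1..N. real a powr (- s)) / m) ^ m)"
    unfolding I_def using assms by (intro mult_left_mono sum_prod_subsets_le) auto
  also have "(\<Sum>a=1..N. real a powr (- s)) \<le> (\<Sum>n. real n powr (- s))"
    using assms by (intro sum_le_suminf) (auto simp: summable_real_powr_iff)
  finally show ?thesis using assms by (simp add: mult_left_mono power_mono divide_right_mono)
qed

lemma omega_density_le:
  assumes "k \<ge> 2" "1 < s" "s \<le> real k" "m > 0"
  shows "omega_density k m \<le> fact m powr (s - k) * (exp (\<Sum>n. real n powr (- s)) / m) ^ m"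
    (is "_ \<le> ?B")
proof -
  define f where "f x = counting (\<lambda>n. omega_mult k n = m) x / x" for x
  obtain l where l: "(f \<longlongrightarrow> l) at_top"
    using omega_density_limit_exists[OF assms(1)] unfolding f_def by blast
  hence "omega_density k m = l"
    unfolding omega_density_def f_def counting_def by (intro tendsto_Lim) auto
  moreover have "l \<le> ?B"
  proof (rule tendsto_upperbound[OF l])
    have "f x \<le> ?B" if "x > 0" for x
      using counting_omega_mult_le[of k s m x] assms that by (simp add: f_def field_simps)
    thus "\<forall>\<^sub>F x in at_top. f x \<le> ?B"
      by (rule eventually_mono[OF eventually_gt_at_top[of 0]])
  qed simp
  ultimately show ?thesis by simp
qed

text \<open>Here \<open>m!\<close> is replaced by \<open>(m / exp(1))\<^sup>m\<close>, which collects everything into one \<open>m\<close>-th power.\<close>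

lemma fact_powr_times_power_le:
  assumes "s \<le> real k" "m > 0"
  shows "fact m powr (s - k) * (exp c / m) ^ m \<le> (exp (c + k - s) * real m powr (s - 1 - k)) ^ m"
proof -
  have "fact m powr (s - k) \<le> ((real m / exp 1) ^ m) powr (s - k)"
    using assms power_div_exp_le_fact[of m] by (intro powr_mono2') auto
  also have "\<dots> = ((real m / exp 1) powr (s - k)) ^ m"
    using assms by (simp add: powr_power mult.commute powr_powr flip: powr_realpow)
  also have "(real m / exp 1) powr (s - k) = exp (k - s) * real m powr (s - k)"
    using assms by (simp add: powr_divide exp_powr_real exp_diff)
  finally have "fact m powr (s - k) * (exp c / m) ^ m
      \<le> (exp (k - s) * real m powr (s - k)) ^ m * (exp c / m) ^ m"
    by (intro mult_right_mono) auto
  also have "\<dots> = (exp (c + k - s) * real m powr (s - 1 - k)) ^ m"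
    using assms
    by (simp add: exp_add exp_diff powr_diff powr_add field_simps flip: power_mult_distrib)
  finally show ?thesis .
qed

theorem corollary4:
  fixes k :: nat
  assumes "k \<ge> 2"
  shows "\<forall>\<epsilon>::real. \<epsilon> > 0 \<longrightarrow>
    (\<exists>m0::nat. \<forall>m\<ge>m0. omega_density k m \<le> real m powr (- ((real k - \<epsilon>) * real m)))"
proof (intro allI impI)
  fix \<epsilon> :: real assume "\<epsilon> > 0"
  \<comment> \<open>One \<open>\<delta>\<close> of the exponent is lost by taking \<open>s = 1 + \<delta>\<close>, another one for absorbing the constant \<open>E\<close>.
    The minimum with 1 ensures \<open>s \<le> k\<close>.\<close>
  define \<delta> where "\<delta> = min \<epsilon> 1 / 2"
  have \<delta>: "\<delta> > 0" "\<delta> < 1" "2 * \<delta> \<le> \<epsilon>" using \<open>\<epsilon> > 0\<close> by (auto simp: \<delta>_def)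
  define s where "s = 1 + \<delta>"
  have s: "1 < s" "s \<le> real k" using \<delta> assms by (auto simp: s_def)
  define E where "E = exp ((\<Sum>n. real n powr (- s)) + k - s)"
  have "LIM m sequentially. real m powr \<delta> :> at_top"
    using \<delta>(1) by real_asymp
  hence "\<forall>\<^sub>F m in sequentially. E \<le> real m powr \<delta>" by (simp add: filterlim_at_top)
  then obtain m1 where m1: "\<And>m. m \<ge> m1 \<Longrightarrow> E \<le> real m powr \<delta>"
    by (auto simp: eventually_sequentially)
  have "omega_density k m \<le> real m powr (- ((real k - \<epsilon>) * real m))" if m: "m \<ge> max m1 1" for m
  proof -
    have "omega_density k m \<le> (E * real m powr (s - 1 - k)) ^ m"
      using omega_density_le[OF assms s, of m] fact_powr_times_power_le[OF s(2), of m] m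
      unfolding E_def by (meson le_trans less_le_trans max.bounded_iff order_trans zero_less_one)
    also have "\<dots> \<le> (real m powr \<delta> * real m powr (s - 1 - k)) ^ m"
      using m1[of m] m by (intro power_mono mult_right_mono) (auto simp: E_def)
    also have "\<dots> = real m powr ((2 * \<delta> - k) * m)"
      using m by (simp add: powr_power s_def algebra_simps flip: powr_add)
    also have "\<dots> \<le> real m powr (- ((real k - \<epsilon>) * real m))"
      using m \<delta> by (intro powr_mono) (auto simp: algebra_simps intro: mult_right_mono)
    finally show ?thesis .
  qed
  thus "\<exists>m0::nat. \<forall>m\<ge>m0. omega_density k m \<le> real m powr (- ((real k - \<epsilon>) * real m))"
    by blast
qed

end
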